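(* Consider the polling model described in the context. If the Markov chain $\mathcal L$ is ergodic, then $$\hat\rho<1\qquad\text{and}\qquad \lambda_i\bar\tau<F_i\ \text{ for all } i\in\mathcal S,$$ where $\hat\rho=\sum_{i=1}^N\lambda_i(\tau_i-\tilde\tau_i)$, $F_i=\mathbb P(S=i)$ under the stationary distribution of $\mathcal L$, and $\bar\tau=\frac{1}{1-\hat\rho}\sum_{j\in\mathcal S}F_j\tilde\tau_j$.
   Context: Polling model. Let $\mathcal S=\{1,\ldots,N\}$ be the set of stations and let $P=(p_{i,j})_{i,j\in\mathcal S}$ and $\widetilde P=(\tilde p_{i,j})_{i,j\in\mathcal S}$ be stochastic matrices. For each $i,j$, $(B_{i,j}(n))_n$ and $(\widetilde B_{i,j}(n))_n$ are sequences of random vectors in $\mathbb Z_+^N$ with finite means, i.i.d. in $n$; the components $B_{i,j;q}(n)$, $q\in\mathcal S$, of each vector may be dependent and have different laws. The process $\mathcal L=(S(n),X(n))_{n\ge 0}$, with $S(n)\in\mathcal S$ (position of the server at polling instant $n$) and $X(n)\in\mathbb Z_+^N$ (queue lengths at polling instant $n$), is the Markov chain on $\mathcal S\times\mathbb Z_+^N$ with the following dynamics. Given the past up to $n$ with $S(n)=i$: - if $X_i(n)>0$, then $S(n+1)=j$ with probability $p_{i,j}$, and in that case $X(n+1)=X(n)-\vec e_i+B_{i,j}(n)$; - if $X_i(n)=0$, then $S(n+1)=j$ with probability $\tilde p_{i,j}$, and in that case $X(n+1)=X(n)+\widetilde B_{i,j}(n)$. Here $\vec e_i$ is the $i$-th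 canonical basis vector, and the routing choices and the vectors $B_{i,j}(n),\widetilde B_{i,j}(n)$ are independent of each other and of the past up to $n$. The chain $\mathcal L$ is assumed irreducible. $(S,X)$ denotes a pair with the stationary distribution. Mean values. It is assumed that $\sum_{j=1}^N p_{i,j}\,\mathbb E B_{i,j;q}(n)=\lambda_q\tau_i$ and $\sum_{j=1}^N\tilde p_{i,j}\,\mathbb E\widetilde B_{i,j;q}(n)=\lambda_q\tilde\tau_i$ for all $i,q\in\mathcal S$. Here $\lambda_q$ is the mean number of arrivals at station $q$ per unit of time, and $\tau_i\ge0$ (resp. $\tilde\tau_i\ge0$) is the mean time between a polling instant at which the server finds station $i$ nonempty (resp. empty) and the next polling instant. *)

theory Defs
  imports "HOL-Probability.Probability"
begin

text \<open>
  A (time-homogeneous) Markov chain on a discrete state space is given by its transition kernel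
  \<open>K :: 'a \<Rightarrow> 'a pmf\<close>, i.e. the transition probability from \<open>x\<close> to \<open>y\<close> is \<open>pmf (K x) y\<close>.
\<close>

primrec n_step :: "('a \<Rightarrow> 'a pmf) \<Rightarrow> nat \<Rightarrow> 'a \<Rightarrow> 'a pmf" where
  "n_step K 0 x = return_pmf x"
| "n_step K (Suc n) x = bind_pmf (n_step K n x) K"

definition irreducible_chain :: "('a \<Rightarrow> 'a pmf) \<Rightarrow> bool" where
  "irreducible_chain K \<longleftrightarrow> (\<forall>x y. \<exists>n. pmf (n_step K n x) y > 0)"

text \<open>
  \<open>first_passage K n x y\<close> is the probability that the chain started in \<open>x\<close> visits \<open>y\<close> for the
  first time after time 0 exactly at time \<open>n\<close>.
\<close>

fun first_passage :: "('a \<Rightarrow> 'a pmf) \<Rightarrow> nat \<Rightarrow> 'a \<Rightarrow> 'a \<Rightarrow> real" where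
  "first_passage K 0 x y = 0"
| "first_passage K (Suc 0) x y = pmf (K x) y"
| "first_passage K (Suc (Suc n)) x y =
     measure_pmf.expectation (K x) (\<lambda>z. if z = y then 0 else first_passage K (Suc n) z y)"

text \<open>The return time to \<open>x\<close> is almost surely finite and has finite mean.\<close>

definition positive_recurrent :: "('a \<Rightarrow> 'a pmf) \<Rightarrow> 'a \<Rightarrow> bool" where
  "positive_recurrent K x \<longleftrightarrow>
     (\<lambda>n. first_passage K n x x) sums 1 \<and> summable (\<lambda>n. real n * first_passage K n x x)"

text \<open>
  No aperiodicity is required: with a cyclic routing of the server the polling chain is periodic.
\<close>

definition ergodic_chain :: "('a \<Rightarrow> 'a pmf) \<Rightarrow> bool" where
  "ergodic_chain K \<longleftrightarrow> irreducible_chain K \<and> (\<forall>x. positive_recurrent K x)"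

definition stationary :: "('a \<Rightarrow> 'a pmf) \<Rightarrow> 'a pmf \<Rightarrow> bool" where
  "stationary K \<pi> \<longleftrightarrow> bind_pmf \<pi> K = \<pi>"

text \<open>Only meaningful for chains with exactly one stationary distribution, e.g. ergodic ones.\<close>

definition stationary_distribution :: "('a \<Rightarrow> 'a pmf) \<Rightarrow> 'a pmf" where
  "stationary_distribution K = (THE \<pi>. stationary K \<pi>)"

text \<open>
  The stations are the elements of a finite type \<open>'s\<close>. A stochastic matrix \<open>P\<close> is represented by
  its rows, so its entries are \<open>p\<^sub>i\<^sub>j = pmf (P i) j\<close>, and \<open>B i j\<close> is the common law of the i.i.d.
  random vectors \<open>B\<^sub>i\<^sub>j(n)\<close> (a joint law, so the components may be dependent).
  The primed versions belong to the case where the server finds the queue empty.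
  A state \<open>(i, x)\<close> consists of the position of the server and the queue lengths.
\<close>

definition polling_kernel ::
  "('s \<Rightarrow> 's pmf) \<Rightarrow> ('s \<Rightarrow> 's \<Rightarrow> ('s \<Rightarrow> nat) pmf) \<Rightarrow>
   ('s \<Rightarrow> 's pmf) \<Rightarrow> ('s \<Rightarrow> 's \<Rightarrow> ('s \<Rightarrow> nat) pmf) \<Rightarrow>
   's \<times> ('s \<Rightarrow> nat) \<Rightarrow> ('s \<times> ('s \<Rightarrow> nat)) pmf" where
  "polling_kernel P B P' B' = (\<lambda>(i, x).
     if x i > 0
     then bind_pmf (P i) (\<lambda>j. map_pmf (\<lambda>b. (j, \<lambda>q. x q - (if q = i then 1 else 0) + b q)) (B i j))
     else bind_pmf (P' i) (\<lambda>j. map_pmf (\<lambda>b. (j, \<lambda>q. x q + b q)) (B' i j)))"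

definition server_frequency :: "('s \<times> ('s \<Rightarrow> nat) \<Rightarrow> ('s \<times> ('s \<Rightarrow> nat)) pmf) \<Rightarrow> 's \<Rightarrow> real" where
  "server_frequency K i = measure_pmf.prob (stationary_distribution K) {(s, x). s = i}"

definition rho_hat :: "('s::finite \<Rightarrow> real) \<Rightarrow> ('s \<Rightarrow> real) \<Rightarrow> ('s \<Rightarrow> real) \<Rightarrow> real" where
  "rho_hat \<Lambda> \<tau> \<tau>' = (\<Sum>i\<in>UNIV. \<Lambda> i * (\<tau> i - \<tau>' i))"

definition tau_bar ::
  "('s::finite \<Rightarrow> real) \<Rightarrow> ('s \<Rightarrow> real) \<Rightarrow> ('s \<Rightarrow> real) \<Rightarrow> ('s \<Rightarrow> real) \<Rightarrow> real" where
  "tau_bar F \<Lambda> \<tau> \<tau>' = 1 / (1 - rho_hat \<Lambda> \<tau> \<tau>') * (\<Sum>j\<in>UNIV. F j * \<tau>' j)"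

end

theory Submission
  imports Defs
begin

text \<open>
  Let \<open>(S, X)\<close> have the stationary law, and split the server frequency \<open>F\<^sub>i\<close> into the probability
  \<open>G\<^sub>i\<close> that the server is at \<open>i\<close> and finds it nonempty and the probability \<open>E\<^sub>i\<close> that it is at \<open>i\<close>
  and finds it empty. Queue \<open>q\<close> loses one customer with probability \<open>G\<^sub>q\<close> per polling instant and
  gains \<open>\<Lambda>\<^sub>q T\<close> customers on average, where \<open>T = (\<Sum>i. G\<^sub>i \<tau>\<^sub>i + E\<^sub>i \<tau>'\<^sub>i)\<close>. In equilibrium the
  two rates agree (\<open>polling_flow_balance\<close>): \<open>G\<^sub>q = \<Lambda>\<^sub>q T\<close>. Inserting this and
  \<open>E\<^sub>i = F\<^sub>i - G\<^sub>i\<close> into the definition of \<open>T\<close> gives \<open>T (1 - \<rho>) = (\<Sum>i. F\<^sub>i \<tau>'\<^sub>i)\<close> with \<open>\<rho> = rho_hat \<Lambda> \<tau> \<tau>'\<close>.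

  By irreducibility the stationary law charges every state (\<open>stationary_positive\<close>), so
  \<open>G\<^sub>q, E\<^sub>q > 0\<close>. Hence \<open>T > 0\<close>, and the right-hand side is positive because otherwise the empty
  system could never be left (\<open>zero_queues_not_absorbing\<close>). Therefore \<open>\<rho> < 1\<close>, \<open>T\<close> equals
  \<open>tau_bar\<close>, and \<open>\<Lambda>\<^sub>i T = G\<^sub>i < F\<^sub>i\<close>.

  Two points need work. First, \<open>stationary_distribution\<close> is a definite description, so a
  stationary law has to be constructed from positive recurrence (\<open>positive_recurrent_stationary\<close>)
  and shown to be unique by irreducibility (\<open>stationary_unique\<close>). Second, \<open>X\<close> need not be integrable, so
  the equality of the rates is not just a difference of two equal expectations; it follows by
  truncation (\<open>stationary_drift_balance\<close>).
\<close>

section \<open>Irreducible chains\<close>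

lemma n_step_front: "n_step K (Suc n) x = bind_pmf (K x) (n_step K n)"
  by (induction n) (simp_all add: bind_return_pmf bind_return_pmf' bind_assoc_pmf)

text \<open>
  A set that the chain cannot leave contains every state that is reachable from one of its points.
  This is the only way in which irreducibility enters: positivity and uniqueness of the stationary
  law, as well as the existence of arrivals at idle polling instants, all come from exhibiting a
  closed set.
\<close>

lemma irreducible_closed_set:
  assumes irr: "irreducible_chain K"
    and closed: "\<And>x. x \<in> A \<Longrightarrow> set_pmf (K x) \<subseteq> A" and "x \<in> A"
  shows "A = UNIV"
proof -
  have "set_pmf (n_step K n x) \<subseteq> A" for n
    using \<open>x \<in> A\<close> closed by (induction n) auto
  moreover have "\<exists>n. y \<in> set_pmf (n_step K n x)" for y
    using irr by (fastforce simp: irreducible_chain_def pmf_positive_iff)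
  ultimately show ?thesis by blast
qed

lemma stationary_positive:
  assumes irr: "irreducible_chain K" and st: "stationary K \<pi>"
  shows "pmf \<pi> x > 0"
proof -
  obtain y where "y \<in> set_pmf \<pi>" using set_pmf_not_empty by fast
  moreover have "set_pmf (K z) \<subseteq> set_pmf \<pi>" if "z \<in> set_pmf \<pi>" for z
    using st that unfolding stationary_def by (metis UN_upper set_bind_pmf)
  ultimately have "set_pmf \<pi> = UNIV" using irreducible_closed_set[OF irr] by metis
  then show ?thesis by (simp add: pmf_positive)
qed

section \<open>Uniqueness of the stationary distribution\<close>

text \<open>
  For two stationary laws, balance the flow into the set \<open>A\<close> on which the first one has the larger
  mass. With \<open>d = \<pi> - \<mu>\<close>, stationarity says that \<open>d(z) K(z, A)\<close> summed over all \<open>z\<close> equals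
  \<open>d\<close> summed over \<open>A\<close>. Since \<open>d\<close> is positive exactly on \<open>A\<close> and \<open>0 \<le> K(z, A) \<le> 1\<close>, this forces
  \<open>K(z, A) = 1\<close> on \<open>A\<close>, so \<open>A\<close> is closed. A nonempty \<open>A\<close> would be the whole space, where
  \<open>\<pi> > \<mu>\<close> contradicts that both have total mass one.
\<close>

lemma stationary_dominated:
  assumes irr: "irreducible_chain K" and \<pi>: "stationary K \<pi>" and \<mu>: "stationary K \<mu>"
  shows "pmf \<pi> x \<le> pmf \<mu> x"
proof (rule ccontr)
  define d where "d z = pmf \<pi> z - pmf \<mu> z" for z
  define A where "A = {z. d z > 0}"
  define k where "k z = measure (K z) A" for z
  assume "\<not> ?thesis"
  then have "x \<in> A" by (simp add: A_def d_def)
  have k01: "0 \<le> k z" "k z \<le> 1" for z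
    by (simp_all add: k_def)
  have d_int: "integrable (count_space UNIV) d"
    unfolding d_def by (intro Bochner_Integration.integrable_diff integrable_pmf)
  have bdd: "integrable (count_space UNIV) (\<lambda>z. d z * g z)" if "\<And>z. \<bar>g z\<bar> \<le> 1" for g :: "_ \<Rightarrow> real"
    by (rule Bochner_Integration.integrable_bound[OF d_int])
       (auto intro!: AE_I2 mult_left_le that simp: abs_mult)
  have pmf_int: "(\<integral>z. pmf p z * g z \<partial>count_space UNIV) = (\<integral>z. g z \<partial>measure_pmf p)"
    for p and g :: "_ \<Rightarrow> real"
    by (simp add: measure_pmf_eq_density integral_density)
  have pmf_intble: "integrable (count_space UNIV) (\<lambda>z. pmf p z * g z)"
    if "\<And>z. \<bar>g z\<bar> \<le> 1" for p and g :: "_ \<Rightarrow> real"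
    by (rule Bochner_Integration.integrable_bound[OF integrable_pmf[of UNIV p]])
       (auto intro!: AE_I2 mult_left_le that simp: abs_mult)
  have flow: "(\<integral>z. k z \<partial>measure_pmf p) = measure p A" if "stationary K p" for p
  proof -
    have "ennreal (\<integral>z. k z \<partial>measure_pmf p) = (\<integral>\<^sup>+z. k z \<partial>measure_pmf p)"
      by (rule nn_integral_eq_integral[symmetric])
         (auto intro!: measure_pmf.integrable_const_bound[where B=1] simp: k01)
    also have "\<dots> = emeasure (bind_pmf p K) A"
      unfolding emeasure_bind_pmf by (simp add: k_def measure_pmf.emeasure_eq_measure)
    also have "\<dots> = ennreal (measure p A)"
      using that by (simp add: stationary_def measure_pmf.emeasure_eq_measure)
    finally show ?thesis by (simp add: integral_nonneg k01)
  qed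
  have split: "(\<integral>z. d z * g z \<partial>count_space UNIV) =
      (\<integral>z. g z \<partial>measure_pmf \<pi>) - (\<integral>z. g z \<partial>measure_pmf \<mu>)"
    if "\<And>z. \<bar>g z\<bar> \<le> 1" for g :: "_ \<Rightarrow> real"
    unfolding d_def left_diff_distrib
    by (subst Bochner_Integration.integral_diff) (auto intro!: pmf_intble that simp: pmf_int)
  have "(\<integral>z. d z * (indicator A z - k z) \<partial>count_space UNIV) = 0"
  proof -
    have "(\<integral>z. d z * (indicator A z - k z) \<partial>count_space UNIV) =
        (\<integral>z. d z * indicator A z \<partial>count_space UNIV) - (\<integral>z. d z * k z \<partial>count_space UNIV)"
      unfolding right_diff_distrib
      by (rule Bochner_Integration.integral_diff) (auto intro!: bdd simp: k01 indicator_def)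
    moreover have "(\<integral>z. d z * indicator A z \<partial>count_space UNIV) = measure \<pi> A - measure \<mu> A"
      by (subst split) (auto simp: indicator_def)
    moreover have "(\<integral>z. d z * k z \<partial>count_space UNIV) = measure \<pi> A - measure \<mu> A"
      by (subst split) (auto simp: k01 flow \<pi> \<mu>)
    ultimately show ?thesis by simp
  qed
  moreover have "0 \<le> d z * (indicator A z - k z)" for z
    using k01[of z] by (auto simp: A_def indicator_def mult_nonpos_nonneg not_less)
  moreover have "integrable (count_space UNIV) (\<lambda>z. d z * (indicator A z - k z))"
  proof (rule bdd)
    show "\<bar>indicator A z - k z\<bar> \<le> 1" for z
      using k01[of z] by (auto simp: indicator_def)
  qed
  ultimately have zero: "d z * (indicator A z - k z) = 0" for z
    by (subst (asm) integral_nonneg_eq_0_iff_AE) (auto simp: AE_count_space)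
  have "k z = 1" if "z \<in> A" for z
  proof -
    have "d z \<noteq> 0" using that by (simp add: A_def)
    then show ?thesis using zero[of z] that by simp
  qed
  then have "set_pmf (K z) \<subseteq> A" if "z \<in> A" for z
    using that measure_pmf.prob_eq_1[of A "K z"] by (auto simp: k_def AE_measure_pmf_iff)
  then have "A = UNIV" using irreducible_closed_set[OF irr] \<open>x \<in> A\<close> by metis
  then have pos: "d z > 0" for z by (auto simp: A_def)
  have "(\<integral>z. d z \<partial>count_space UNIV) = 0"
    using split[of "\<lambda>_. 1"] by simp
  then have "d x = 0"
    using pos by (subst (asm) integral_nonneg_eq_0_iff_AE[OF d_int]) (auto simp: AE_count_space less_imp_le)
  with pos[of x] show False by simp
qed

lemma stationary_unique:
  assumes "irreducible_chain K" "stationary K \<pi>" "stationary K \<mu>"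
  shows "\<pi> = \<mu>"
  using assms by (intro pmf_eqI antisym stationary_dominated)

section \<open>Existence of a stationary distribution\<close>

text \<open>
  \<open>None\<close> is the cemetery. Only an arrival in \<open>a\<close> kills the chain, so a start in \<open>Some a\<close> is alive
  at time 0 and the killing time is the return time to \<open>a\<close>.
  Representing the taboo probabilities by a genuine Markov kernel on \<open>'a option\<close> makes the
  associativity of the Kleisli composition of \<open>pmf\<close>s available for them.
\<close>

definition killed :: "('a \<Rightarrow> 'a pmf) \<Rightarrow> 'a \<Rightarrow> 'a option \<Rightarrow> 'a option pmf" where
  "killed K a = case_option (return_pmf None)
     (\<lambda>x. map_pmf (\<lambda>y. if y = a then None else Some y) (K x))"

lemma pmf_killed:
  "pmf (killed K a None) None = 1"
  "pmf (killed K a None) (Some y) = 0"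
  "pmf (killed K a (Some x)) None = pmf (K x) a"
  "pmf (killed K a (Some x)) (Some y) = (if y = a then 0 else pmf (K x) y)"
proof -
  have "(\<lambda>z. if z = a then None else Some z) -` {None} = {a}" by (auto split: if_splits)
  then show "pmf (killed K a (Some x)) None = pmf (K x) a"
    by (simp add: killed_def pmf_map measure_pmf_single)
  have "(\<lambda>z. if z = a then None else Some z) -` {Some y} = (if y = a then {} else {y})" by (auto split: if_splits)
  then show "pmf (killed K a (Some x)) (Some y) = (if y = a then 0 else pmf (K x) y)"
    by (simp add: killed_def pmf_map measure_pmf_single)
qed (simp_all add: killed_def)

lemma first_passage_bounds: "0 \<le> first_passage K n x y \<and> first_passage K n x y \<le> 1"
proof (induction K n x y rule: first_passage.induct)
  case (3 K n x y)
  have "integrable (K x) (\<lambda>z. if z = y then 0 else first_passage K (Suc n) z y)"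
    using 3 by (intro measure_pmf.integrable_const_bound[where B=1]) auto
  then show ?case
    using 3 by (auto intro!: integral_nonneg measure_pmf.integral_le_const)
qed (auto simp: pmf_le_1)

text \<open>
  To be in the cemetery at time \<open>n\<close> means that the first visit to \<open>a\<close> happened by then. Since
  \<open>first_passage\<close> conditions on the first step while \<open>n_step\<close> appends the last one, the induction
  uses \<open>n_step_front\<close> and ranges over all starting points.
\<close>

lemma killed_absorbed:
  "pmf (n_step (killed K a) n (Some x)) None = (\<Sum>k\<le>n. first_passage K k x a)"
proof (induction n arbitrary: x)
  case (Suc n)
  have none: "n_step (killed K a) n None = return_pmf None" for n
    by (induction n) (simp_all add: bind_return_pmf killed_def)
  have int: "integrable (K x) (\<lambda>y. if y = a then 0 else first_passage K k y a)" for k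
    using first_passage_bounds[of K k] by (intro measure_pmf.integrable_const_bound[where B=1]) auto
  have "pmf (n_step (killed K a) (Suc n) (Some x)) None =
      (\<integral>y. (if y = a then 1 else \<Sum>k\<le>n. first_passage K k y a) \<partial>K x)"
    unfolding n_step_front killed_def[of K a] option.case bind_map_pmf pmf_bind
    by (intro Bochner_Integration.integral_cong) (auto simp: none Suc killed_def[symmetric])
  also have "\<dots> = (\<integral>y. indicator {a} y + (\<Sum>k<n. if y = a then 0 else first_passage K (Suc k) y a) \<partial>K x)"
    by (intro Bochner_Integration.integral_cong) 
       (auto simp: lessThan_Suc_atMost[symmetric] sum.lessThan_Suc_shift simp del: sum.lessThan_Suc)
  also have "\<dots> = pmf (K x) a + (\<Sum>k<n. \<integral>y. (if y = a then 0 else first_passage K (Suc k) y a) \<partial>K x)"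
    using int by (subst Bochner_Integration.integral_add)
      (auto simp: measure_pmf_single intro!: Bochner_Integration.integral_sum
        Bochner_Integration.integrable_sum measure_pmf.integrable_const_bound[where B=1])
  also have "\<dots> = (\<Sum>k\<le>Suc n. first_passage K k x a)"
    by (simp add: lessThan_Suc_atMost[symmetric] sum.lessThan_Suc_shift del: sum.lessThan_Suc)
  finally show ?case .
qed simp

lemma nn_integral_count_space_option:
  fixes f :: "'a option \<Rightarrow> ennreal"
  assumes "f None = 0"
  shows "(\<integral>\<^sup>+z. f z \<partial>count_space UNIV) = (\<integral>\<^sup>+x. f (Some x) \<partial>count_space UNIV)"
proof -
  have "(\<integral>\<^sup>+z. f z \<partial>count_space UNIV) = (\<integral>\<^sup>+z. f z \<partial>count_space (range Some))"
  proof (rule nn_integral_count_space_eq)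
    show "f z = 0" if "z \<in> UNIV - range Some" for z
      using that assms by (cases z) auto
  qed auto
  also have "\<dots> = (\<integral>\<^sup>+x. f (Some x) \<partial>count_space UNIV)"
    by (rule nn_integral_bij_count_space[symmetric]) (auto simp: bij_betw_def)
  finally show ?thesis .
qed

text \<open>
  The expectation of an \<open>\<nat>\<close>-valued random variable is the sum of its tails. Only the inequality
  is shown: it makes the expected occupation measure of an excursion finite.
\<close>

lemma sum_tails_le:
  fixes f :: "nat \<Rightarrow> real"
  assumes f: "\<And>n. f n \<ge> 0" and s: "f sums 1" and m: "summable (\<lambda>n. real n * f n)"
  shows "(\<Sum>n<N. 1 - (\<Sum>k\<le>n. f k)) \<le> (\<Sum>n. real n * f n)"
proof -
  \<comment> \<open>Summation by parts; the boundary term is then absorbed by the remaining tail of the mean.\<close>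
  have abel: "(\<Sum>n<N. 1 - (\<Sum>k\<le>n. f k)) =
      real N * (1 - (\<Sum>k\<le>N. f k)) + (\<Sum>k\<le>N. real k * f k)"
    by (induction N) (simp_all add: algebra_simps)
  have sf: "summable f" and one: "suminf f = 1"
    using s by (auto simp: sums_iff)
  have "real N * (1 - (\<Sum>k\<le>N. f k)) = (\<Sum>k. real N * f (k + Suc N))"
    using suminf_minus_initial_segment[OF sf, of "Suc N"] sf
    by (simp add: one lessThan_Suc_atMost suminf_mult summable_iff_shift flip: add_Suc_right)
  also have "\<dots> \<le> (\<Sum>k. real (k + Suc N) * f (k + Suc N))"
    using sf m summable_ignore_initial_segment[OF m, of "Suc N"]
    by (intro suminf_le summable_mult mult_right_mono f summable_ignore_initial_segment)
       simp_all
  also have "\<dots> = (\<Sum>n. real n * f n) - (\<Sum>k\<le>N. real k * f k)"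
    using suminf_minus_initial_segment[OF m, of "Suc N"] by (simp add: lessThan_Suc_atMost)
  finally show ?thesis using abel by simp
qed

text \<open>
  The classical cycle construction: \<open>\<nu> y\<close> is the expected number of visits to \<open>y\<close> during one
  excursion from \<open>a\<close>, counting time 0 but not the time of return. One further step moves the visits
  at times \<open>0, \<dots>, T - 1\<close> to the visits at times \<open>1, \<dots>, T\<close>; as the excursion starts and almost
  surely ends in \<open>a\<close>, the measure \<open>\<nu>\<close> is invariant. Its total mass is the mean return time, which
  is finite, so it can be normalised.
\<close>

lemma positive_recurrent_stationary:
  assumes "positive_recurrent K a"
  shows "\<exists>\<pi>. stationary K \<pi>"
proof -
  define f where "f n = first_passage K n a a" for n
  define u where "u n = n_step (killed K a) n (Some a)" for n
  define \<nu> where "\<nu> y = (\<Sum>n. ennreal (pmf (u n) (Some y)))" for y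
  define C where "C = (\<integral>\<^sup>+y. \<nu> y \<partial>count_space UNIV)"
  have f0: "f n \<ge> 0" for n using first_passage_bounds[of K n a a] by (simp add: f_def)
  have f1: "f sums 1" and fm: "summable (\<lambda>n. real n * f n)"
    using assms by (simp_all add: positive_recurrent_def f_def[abs_def])
  have uSuc: "u (Suc n) = bind_pmf (u n) (killed K a)" for n by (simp add: u_def)
  have u0: "u 0 = return_pmf (Some a)" by (simp add: u_def)
  have None: "pmf (u n) None = (\<Sum>k\<le>n. f k)" for n
    by (simp add: u_def killed_absorbed f_def)

  have flow: "(\<integral>\<^sup>+x. ennreal (pmf (u n) (Some x)) * h x \<partial>count_space UNIV) =
      (\<integral>\<^sup>+z. (case z of None \<Rightarrow> 0 | Some x \<Rightarrow> h x) \<partial>u n)" for n h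
    unfolding nn_integral_measure_pmf
    by (subst nn_integral_count_space_option) simp_all
  have \<nu>_flow: "(\<integral>\<^sup>+x. \<nu> x * h x \<partial>count_space UNIV) =
      (\<Sum>n. \<integral>\<^sup>+z. (case z of None \<Rightarrow> 0 | Some x \<Rightarrow> h x) \<partial>u n)" for h
  proof -
    have "(\<integral>\<^sup>+x. \<nu> x * h x \<partial>count_space UNIV) =
        (\<integral>\<^sup>+x. (\<Sum>n. ennreal (pmf (u n) (Some x)) * h x) \<partial>count_space UNIV)"
      by (simp add: \<nu>_def)
    also have "\<dots> = (\<Sum>n. \<integral>\<^sup>+x. ennreal (pmf (u n) (Some x)) * h x \<partial>count_space UNIV)"
      by (rule nn_integral_suminf) simp
    finally show ?thesis by (simp only: flow)
  qed

  have \<nu>_shift: "\<nu> y = ennreal (pmf (u 0) (Some y)) + (\<Sum>n. ennreal (pmf (u (Suc n)) (Some y)))" for y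
  proof -
    have "\<nu> y = (\<Sum>n. ennreal (pmf (u (n + 1)) (Some y))) + (\<Sum>n<1. ennreal (pmf (u n) (Some y)))"
      unfolding \<nu>_def by (rule suminf_offset) (rule summableI)
    also have "(\<Sum>n<1. ennreal (pmf (u n) (Some y))) = ennreal (pmf (u 0) (Some y))"
      by simp
    finally show ?thesis
      by (simp only: add.commute Suc_eq_plus1)
  qed
  \<comment> \<open>The mass sent by \<open>\<nu>\<close> to \<open>y \<noteq> a\<close> is the surviving mass one step later; the mass sent to \<open>a\<close>
    at step \<open>n\<close> is the probability of a first return at time \<open>n + 1\<close>, and these add up to 1.\<close>
  have inv: "(\<integral>\<^sup>+x. \<nu> x * pmf (K x) y \<partial>count_space UNIV) = \<nu> y" for y
  proof (cases "y = a")
    case False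
    have "(\<integral>\<^sup>+z. (case z of None \<Rightarrow> 0 | Some x \<Rightarrow> ennreal (pmf (K x) y)) \<partial>u n) =
        ennreal (pmf (u (Suc n)) (Some y))" for n
      unfolding uSuc ennreal_pmf_bind using False
      by (intro nn_integral_cong) (auto simp: pmf_killed split: option.split)
    then show ?thesis
      unfolding \<nu>_flow using False by (simp add: \<nu>_shift u0)
  next
    case True
    have "(\<integral>\<^sup>+z. (case z of None \<Rightarrow> 0 | Some x \<Rightarrow> ennreal (pmf (K x) a)) \<partial>u n) =
        ennreal (f (Suc n))" (is "?I = _") for n
    proof -
      have "ennreal (pmf (u (Suc n)) None) =
          (\<integral>\<^sup>+z. indicator {None} z + (case z of None \<Rightarrow> 0 | Some x \<Rightarrow> ennreal (pmf (K x) a)) \<partial>u n)"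
        unfolding uSuc ennreal_pmf_bind
        by (intro nn_integral_cong) (auto simp: pmf_killed split: option.split)
      also have "\<dots> = ennreal (pmf (u n) None) + ?I"
        by (subst nn_integral_add) (simp_all add: emeasure_pmf_single)
      finally have "ennreal (pmf (u n) None) + ennreal (f (Suc n)) = ennreal (pmf (u n) None) + ?I"
        using f0 by (simp add: None sum_nonneg flip: ennreal_plus)
      then show ?thesis by (simp add: ennreal_add_left_cancel)
    qed
    moreover have "(\<Sum>n. ennreal (f (Suc n))) = 1"
    proof -
      have "(\<lambda>n. f (Suc n)) sums 1"
        using f1 by (subst sums_Suc_iff) (simp add: f_def)
      then show ?thesis using f0 by (simp add: suminf_ennreal2 sums_iff)
    qed
    moreover have "pmf (u (Suc n)) (Some a) = 0" for n
    proof -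
      have "pmf (killed K a z) (Some a) = 0" for z
        by (cases z) (simp_all add: pmf_killed)
      then show ?thesis by (simp add: uSuc pmf_bind)
    qed
    ultimately show ?thesis
      unfolding \<nu>_flow using True by (simp add: \<nu>_shift u0)
  qed

  have "C = (\<Sum>n. ennreal (1 - (\<Sum>k\<le>n. f k)))"
  proof -
    have "(\<integral>\<^sup>+z. (case z of None \<Rightarrow> 0 | Some x \<Rightarrow> 1) \<partial>u n) = ennreal (1 - (\<Sum>k\<le>n. f k))" for n
    proof -
      have "(\<integral>\<^sup>+z. (case z of None \<Rightarrow> 0 | Some x \<Rightarrow> 1) \<partial>u n) = (\<integral>\<^sup>+z. indicator (UNIV - {None}) z \<partial>u n)"
        by (intro nn_integral_cong) (auto split: option.split)
      also have "\<dots> = ennreal (1 - pmf (u n) None)"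
        using measure_pmf.prob_compl[of "{None}" "u n"]
        by (simp add: measure_pmf.emeasure_eq_measure measure_pmf_single)
      finally show ?thesis by (simp add: None)
    qed
    then show ?thesis
      using \<nu>_flow[of "\<lambda>_. 1"] by (simp add: C_def)
  qed
  also have "\<dots> \<le> ennreal (\<Sum>n. real n * f n)"
  proof (rule suminf_le_const)
    fix N
    have "0 \<le> 1 - (\<Sum>k\<le>n. f k)" for n
      using pmf_le_1[of "u n" None] by (simp add: None)
    then show "(\<Sum>n<N. ennreal (1 - (\<Sum>k\<le>n. f k))) \<le> ennreal (\<Sum>n. real n * f n)"
      using sum_tails_le[OF f0 f1 fm, of N] by (subst sum_ennreal) (auto intro: ennreal_leI)
  qed simp
  finally have Cfin: "C < \<infinity>" by (simp add: le_less_trans)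
  have le_C: "\<nu> y \<le> C" for y
    unfolding C_def by (rule nn_integral_ge_point) simp
  have "\<nu> a \<ge> 1"
    by (simp add: \<nu>_shift u0)
  then have C0: "C \<noteq> 0" using le_C[of a] by auto

  define p where "p y = enn2real (\<nu> y / C)" for y
  have p: "ennreal (p y) = \<nu> y / C" for y
  proof -
    have "\<nu> y < \<top>"
      using le_C[of y] Cfin by (simp add: le_less_trans)
    then have "\<nu> y / C \<noteq> \<top>"
      using C0 by (auto simp: ennreal_divide_eq_top_iff)
    then have "\<nu> y / C < \<top>"
      by (simp only: less_top)
    then show ?thesis by (simp add: p_def)
  qed
  have p1: "(\<integral>\<^sup>+y. ennreal (p y) \<partial>count_space UNIV) = 1"
  proof -
    have "(\<integral>\<^sup>+y. ennreal (p y) \<partial>count_space UNIV) = C / C"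
      unfolding p C_def by (rule nn_integral_divide) simp
    also have "\<dots> = 1"
      by (rule ennreal_divide_self) (use C0 Cfin in auto)
    finally show ?thesis .
  qed
  have pmf_p: "pmf (embed_pmf p) y = p y" for y
    by (rule pmf_embed_pmf) (simp add: p_def, rule p1)
  have "pmf (bind_pmf (embed_pmf p) K) y = pmf (embed_pmf p) y" for y
  proof -
    have "ennreal (pmf (bind_pmf (embed_pmf p) K) y) =
        (\<integral>\<^sup>+x. ennreal (pmf (embed_pmf p) x) * ennreal (pmf (K x) y) \<partial>count_space UNIV)"
      by (simp only: ennreal_pmf_bind nn_integral_measure_pmf)
    also have "\<dots> = (\<integral>\<^sup>+x. (\<nu> x * pmf (K x) y) / C \<partial>count_space UNIV)"
      by (simp only: pmf_p p divide_ennreal_def mult.assoc mult.commute[of "inverse C"])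
    also have "\<dots> = (\<integral>\<^sup>+x. \<nu> x * pmf (K x) y \<partial>count_space UNIV) / C"
      by (rule nn_integral_divide) simp
    also have "\<dots> = ennreal (pmf (embed_pmf p) y)"
      by (simp only: inv pmf_p p)
    finally show ?thesis
      by (rule ennreal_inj[THEN iffD1, rotated 2]) simp_all
  qed
  then have "stationary K (embed_pmf p)"
    unfolding stationary_def by (rule pmf_eqI)
  then show ?thesis ..
qed

lemma stationary_stationary_distribution:
  assumes "ergodic_chain K"
  shows "stationary K (stationary_distribution K)"
proof -
  have irr: "irreducible_chain K"
    using assms by (simp add: ergodic_chain_def)
  have "positive_recurrent K undefined"
    using assms by (simp add: ergodic_chain_def)
  from positive_recurrent_stationary[OF this] obtain \<pi> where \<pi>: "stationary K \<pi>" ..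
  show ?thesis
    unfolding stationary_distribution_def
  proof (rule theI[where P="stationary K"])
    show "stationary K \<pi>" by (rule \<pi>)
    show "\<mu> = \<pi>" if "stationary K \<mu>" for \<mu>
      by (rule stationary_unique[OF irr that \<pi>])
  qed
qed

section \<open>Zero mean drift in the stationary regime\<close>

text \<open>
  If \<open>c\<close> bounds the possible decrease of \<open>f\<close> in one step and \<open>D\<close> is the mean of the compensated
  increment, then in equilibrium the mean increment \<open>D - c\<close> integrates to 0. This would be
  immediate if \<open>f\<close> were integrable, but a stationary queue length may have infinite mean.
  The increment however is integrable, so one can clip \<open>f\<close> to \<open>[-n, n]\<close>: clipping is 1-Lipschitz,
  hence the clipped increments are dominated by the unclipped ones, and each of them has mean 0.
\<close>

lemma stationary_drift_balance:
  fixes f c D :: "'a \<Rightarrow> real"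
  assumes st: "stationary K \<pi>"
    and c_int: "integrable (measure_pmf \<pi>) c"
    and D_int: "integrable (measure_pmf \<pi>) D" and D0: "\<And>x. 0 \<le> D x"
    and jump: "\<And>x y. y \<in> set_pmf (K x) \<Longrightarrow> 0 \<le> f y - f x + c x"
    and mean: "\<And>x. (\<integral>\<^sup>+y. ennreal (f y - f x + c x) \<partial>measure_pmf (K x)) = ennreal (D x)"
  shows "measure_pmf.expectation \<pi> D = measure_pmf.expectation \<pi> c"
proof -
  \<comment> \<open>The joint law of two consecutive states in equilibrium.\<close>
  define J where "J = bind_pmf \<pi> (\<lambda>x. map_pmf (Pair x) (K x))"
  define up where "up z = f (snd z) - f (fst z) + c (fst z)" for z
  define step where "step z = f (snd z) - f (fst z)" for z
  define clip where "clip n t = max (- real n) (min (real n) t)" for n and t :: real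
  have fst_J: "map_pmf fst J = \<pi>"
    by (simp add: J_def map_bind_pmf pmf.map_comp o_def bind_return_pmf' map_pmf_const)
  have snd_J: "map_pmf snd J = \<pi>"
    using st by (simp add: J_def map_bind_pmf pmf.map_comp o_def stationary_def)

  have "(\<integral>\<^sup>+z. ennreal (up z) \<partial>measure_pmf J) = ennreal (measure_pmf.expectation \<pi> D)"
    using D0 by (simp add: J_def up_def mean nn_integral_eq_integral[OF D_int])
  moreover have "AE z in measure_pmf J. 0 \<le> up z"
    by (auto simp: AE_measure_pmf_iff J_def up_def jump)
  ultimately have up: "integrable (measure_pmf J) up" "measure_pmf.expectation J up = measure_pmf.expectation \<pi> D"
    using D0 by (auto simp: nn_integral_eq_integrable integral_nonneg)
  have c: "integrable (measure_pmf J) (\<lambda>z. c (fst z))"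
    "measure_pmf.expectation J (\<lambda>z. c (fst z)) = measure_pmf.expectation \<pi> c"
    using c_int integral_map_pmf[of fst J c] integrable_map_pmf_eq[of fst J c] by (simp_all add: fst_J)
  have step_eq: "step = (\<lambda>z. up z - c (fst z))"
    by (auto simp: step_def up_def)
  have step_int: "integrable (measure_pmf J) step"
    unfolding step_eq using up c by simp
  have step_mean: "measure_pmf.expectation J step =
      measure_pmf.expectation \<pi> D - measure_pmf.expectation \<pi> c"
    unfolding step_eq using up c by simp

  have clip_le: "\<bar>clip n t\<bar> \<le> real n" for n t
    by (auto simp: clip_def)
  have clip_int: "integrable (measure_pmf p) (\<lambda>z. clip n (h z))" for p n and h :: "_ \<Rightarrow> real"
    by (rule measure_pmf.integrable_const_bound[where B="real n"]) (auto simp: clip_le)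
  have zero: "measure_pmf.expectation J (\<lambda>z. clip n (f (snd z)) - clip n (f (fst z))) = 0" for n
  proof -
    have "measure_pmf.expectation J (\<lambda>z. clip n (f (snd z))) = measure_pmf.expectation \<pi> (\<lambda>x. clip n (f x))"
      using integral_map_pmf[of snd J "\<lambda>x. clip n (f x)"] by (simp add: snd_J)
    moreover have "measure_pmf.expectation J (\<lambda>z. clip n (f (fst z))) = measure_pmf.expectation \<pi> (\<lambda>x. clip n (f x))"
      using integral_map_pmf[of fst J "\<lambda>x. clip n (f x)"] by (simp add: fst_J)
    ultimately show ?thesis
      by (simp add: clip_int)
  qed
  have clip_lim: "(\<lambda>n. clip n t) \<longlonglongrightarrow> t" for t
  proof (rule tendsto_eventually)
    obtain m where m: "\<bar>t\<bar> \<le> real m" using real_arch_simple by blast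
    show "\<forall>\<^sub>F n in sequentially. clip n t = t"
      using eventually_ge_at_top[of m]
    proof eventually_elim
      case (elim n)
      then have "\<bar>t\<bar> \<le> real n" using m by linarith
      then show ?case by (auto simp: clip_def)
    qed
  qed
  have "(\<lambda>n. measure_pmf.expectation J (\<lambda>z. clip n (f (snd z)) - clip n (f (fst z))))
      \<longlonglongrightarrow> measure_pmf.expectation J step"
  proof (rule integral_dominated_convergence[where w="\<lambda>z. \<bar>step z\<bar>"])
    show "AE z in measure_pmf J. (\<lambda>n. clip n (f (snd z)) - clip n (f (fst z))) \<longlonglongrightarrow> step z"
      unfolding step_def by (intro AE_I2 tendsto_diff clip_lim)
    show "AE z in measure_pmf J. norm (clip n (f (snd z)) - clip n (f (fst z))) \<le> \<bar>step z\<bar>" for n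
      by (intro AE_I2) (auto simp: clip_def step_def)
  qed (use step_int in auto)
  then have "measure_pmf.expectation J step = 0"
    by (simp add: zero LIMSEQ_const_iff)
  with step_mean show ?thesis by simp
qed

section \<open>The polling model\<close>

lemma nn_integral_routing:
  fixes p :: "'s::finite pmf" and A :: "'s \<Rightarrow> ('s \<Rightarrow> nat) pmf"
  assumes int: "\<And>j. integrable (measure_pmf (A j)) (\<lambda>b. real (b q))"
    and mean: "(\<Sum>j\<in>UNIV. pmf p j * measure_pmf.expectation (A j) (\<lambda>b. real (b q))) = m"
  shows "(\<integral>\<^sup>+j. \<integral>\<^sup>+b. ennreal (real (b q)) \<partial>measure_pmf (A j) \<partial>measure_pmf p) = ennreal m"
proof -
  have "(\<integral>\<^sup>+b. ennreal (real (b q)) \<partial>measure_pmf (A j)) = ennreal (measure_pmf.expectation (A j) (\<lambda>b. real (b q)))" for j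
    by (rule nn_integral_eq_integral) (auto simp: int)
  then have "(\<integral>\<^sup>+j. \<integral>\<^sup>+b. ennreal (real (b q)) \<partial>measure_pmf (A j) \<partial>measure_pmf p) =
      (\<Sum>j\<in>UNIV. ennreal (measure_pmf.expectation (A j) (\<lambda>b. real (b q))) * ennreal (pmf p j))"
    by (simp only:) (rule nn_integral_measure_pmf_support; simp)
  also have "\<dots> = ennreal (\<Sum>j\<in>UNIV. pmf p j * measure_pmf.expectation (A j) (\<lambda>b. real (b q)))"
    by (subst sum_ennreal[symmetric]) (auto simp: ennreal_mult' mult.commute)
  finally show ?thesis by (simp add: mean)
qed

text \<open>
  In equilibrium, the mean number of departures from queue \<open>q\<close> per polling instant equals the mean
  number of arrivals there. A customer leaves queue \<open>q\<close> exactly when the server polls \<open>q\<close> and finds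
  it nonempty, whence the left-hand side; \<open>m i\<close> and \<open>m' i\<close> are the mean numbers of arrivals at
  \<open>q\<close> after a polling instant at a nonempty, respectively empty, station \<open>i\<close>.
\<close>

lemma polling_flow_balance:
  fixes P P' :: "'s::finite \<Rightarrow> 's pmf"
    and B B' :: "'s \<Rightarrow> 's \<Rightarrow> ('s \<Rightarrow> nat) pmf"
    and m m' :: "'s \<Rightarrow> real"
  assumes B: "\<And>i j. integrable (measure_pmf (B i j)) (\<lambda>b. real (b q))"
    and B': "\<And>i j. integrable (measure_pmf (B' i j)) (\<lambda>b. real (b q))"
    and m: "\<And>i. (\<Sum>j\<in>UNIV. pmf (P i) j * measure_pmf.expectation (B i j) (\<lambda>b. real (b q))) = m i"
    and m': "\<And>i. (\<Sum>j\<in>UNIV. pmf (P' i) j * measure_pmf.expectation (B' i j) (\<lambda>b. real (b q))) = m' i"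
    and st: "stationary (polling_kernel P B P' B') \<pi>"
  shows "measure_pmf.prob \<pi> {(s, x). s = q \<and> x s > 0} =
    (\<Sum>i\<in>UNIV. measure_pmf.prob \<pi> {(s, x). s = i \<and> x s > 0} * m i
              + measure_pmf.prob \<pi> {(s, x). s = i \<and> x s = 0} * m' i)"
proof -
  define busy idle :: "'s \<Rightarrow> ('s \<times> ('s \<Rightarrow> nat)) set" where
    "busy i = {(s, x). s = i \<and> x s > 0}" and "idle i = {(s, x). s = i \<and> x s = 0}" for i
  define f :: "'s \<times> ('s \<Rightarrow> nat) \<Rightarrow> real" where "f z = real (snd z q)" for z
  define c :: "'s \<times> ('s \<Rightarrow> nat) \<Rightarrow> real" where "c = indicator (busy q)"
  define D where "D z = (\<Sum>i\<in>UNIV. indicator (busy i) z * m i + indicator (idle i) z * m' i)" for z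
  have m0: "0 \<le> m i" "0 \<le> m' i" for i
    unfolding m[symmetric] m'[symmetric] by (auto intro!: sum_nonneg mult_nonneg_nonneg integral_nonneg)
  have D_eq: "D (i, x) = (if x i > 0 then m i else m' i)" for i x
  proof -
    have "D (i, x) = (\<Sum>k\<in>UNIV. if k = i then (if x i > 0 then m i else m' i) else 0)"
      unfolding D_def by (intro sum.cong) (auto simp: busy_def idle_def)
    then show ?thesis by simp
  qed
  have ind_int: "integrable (measure_pmf \<pi>) (indicator A :: _ \<Rightarrow> real)" for A
    by (rule measure_pmf.integrable_const_bound[where B=1]) (auto simp: indicator_def)
  have "measure_pmf.expectation \<pi> D = measure_pmf.expectation \<pi> c"
  proof (rule stationary_drift_balance[OF st, of c D f])
    show "integrable (measure_pmf \<pi>) c" by (simp add: c_def ind_int)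
    show "integrable (measure_pmf \<pi>) D"
      unfolding D_def by (intro Bochner_Integration.integrable_sum Bochner_Integration.integrable_add
        integrable_mult_left ind_int)
    show "0 \<le> D z" for z
      by (cases z) (simp add: D_eq m0)
    show "0 \<le> f y - f z + c z" if "y \<in> set_pmf (polling_kernel P B P' B' z)" for z y
      using that by (cases z) (auto simp: polling_kernel_def f_def c_def busy_def split: if_splits)
    show "(\<integral>\<^sup>+y. ennreal (f y - f z + c z) \<partial>measure_pmf (polling_kernel P B P' B' z)) = ennreal (D z)" for z
    proof (cases z)
      case (Pair i x)
      show ?thesis
      proof (cases "x i > 0")
        case True
        have "f (j, \<lambda>k. x k - (if k = i then 1 else 0) + b k) - f (i, x) + c (i, x) = real (b q)" for j b
          using True by (auto simp: f_def c_def busy_def)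
        then show ?thesis
          using True nn_integral_routing[OF B m, of i]
          by (simp add: Pair polling_kernel_def D_eq)
      next
        case False
        have "f (j, \<lambda>k. x k + b k) - f (i, x) + c (i, x) = real (b q)" for j b
          using False by (auto simp: f_def c_def busy_def)
        then show ?thesis
          using False nn_integral_routing[OF B' m', of i]
          by (simp add: Pair polling_kernel_def D_eq)
      qed
    qed
  qed
  moreover have "measure_pmf.expectation \<pi> c = measure_pmf.prob \<pi> (busy q)"
    by (simp add: c_def)
  moreover have "measure_pmf.expectation \<pi> D =
      (\<Sum>i\<in>UNIV. measure_pmf.prob \<pi> (busy i) * m i + measure_pmf.prob \<pi> (idle i) * m' i)"
    unfolding D_def
    by (subst Bochner_Integration.integral_sum)
       (auto intro!: Bochner_Integration.integrable_add integrable_mult_left ind_int sum.cong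
         simp: Bochner_Integration.integral_add ind_int)
  ultimately show ?thesis by (simp add: busy_def idle_def)
qed

text \<open>
  If no customer ever arrived after an idle polling instant, then a system with all queues empty
  would remain empty forever.
\<close>

lemma zero_queues_not_absorbing:
  fixes P P' :: "'s::finite \<Rightarrow> 's pmf"
    and B B' :: "'s \<Rightarrow> 's \<Rightarrow> ('s \<Rightarrow> nat) pmf"
  assumes irr: "irreducible_chain (polling_kernel P B P' B')"
    and B': "\<And>i j q. integrable (measure_pmf (B' i j)) (\<lambda>b. real (b q))"
  shows "\<exists>i q. (\<Sum>j\<in>UNIV. pmf (P' i) j * measure_pmf.expectation (B' i j) (\<lambda>b. real (b q))) \<noteq> 0"
proof (rule ccontr)
  assume "\<not> ?thesis"
  then have zero: "(\<Sum>j\<in>UNIV. pmf (P' i) j * measure_pmf.expectation (B' i j) (\<lambda>b. real (b q))) = 0" for i q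
    by blast
  have no_arrivals: "b q = 0" if "j \<in> set_pmf (P' i)" "b \<in> set_pmf (B' i j)" for i j b q
  proof -
    have "pmf (P' i) j * measure_pmf.expectation (B' i j) (\<lambda>b. real (b q)) = 0"
      using zero[of i q] by (subst (asm) sum_nonneg_eq_0_iff) (auto intro!: mult_nonneg_nonneg integral_nonneg)
    then have "measure_pmf.expectation (B' i j) (\<lambda>b. real (b q)) = 0"
      using that by (simp add: set_pmf_iff)
    then have "AE b in measure_pmf (B' i j). real (b q) = 0"
      by (subst (asm) integral_nonneg_eq_0_iff_AE[OF B']) auto
    then show ?thesis using that by (simp add: AE_measure_pmf_iff)
  qed
  \<comment> \<open>The type of stations is nonempty, so \<open>undefined\<close> below is some station.\<close>
  define A :: "('s \<times> ('s \<Rightarrow> nat)) set" where "A = UNIV \<times> {\<lambda>_. 0}"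
  have "A = UNIV"
  proof (rule irreducible_closed_set[OF irr])
    show "(undefined, \<lambda>_. 0) \<in> A" by (simp add: A_def)
    show "set_pmf (polling_kernel P B P' B' z) \<subseteq> A" if "z \<in> A" for z
      using that by (auto simp: A_def polling_kernel_def fun_eq_iff no_arrivals)
  qed
  moreover have "(undefined, \<lambda>_. 1) \<notin> A" by (simp add: A_def fun_eq_iff)
  ultimately show False by simp
qed

theorem theorem4p1:
  fixes P P' :: "'s::finite \<Rightarrow> 's pmf"
    and B B' :: "'s \<Rightarrow> 's \<Rightarrow> ('s \<Rightarrow> nat) pmf"
    and \<Lambda> \<tau> \<tau>' :: "'s \<Rightarrow> real"
  assumes "\<And>i j q. integrable (measure_pmf (B i j)) (\<lambda>b. real (b q))"
    and "\<And>i j q. integrable (measure_pmf (B' i j)) (\<lambda>b. real (b q))"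
    and "\<And>i. \<tau> i \<ge> 0" and "\<And>i. \<tau>' i \<ge> 0"
    and "\<And>i q. (\<Sum>j\<in>UNIV. pmf (P i) j * measure_pmf.expectation (B i j) (\<lambda>b. real (b q))) = \<Lambda> q * \<tau> i"
    and "\<And>i q. (\<Sum>j\<in>UNIV. pmf (P' i) j * measure_pmf.expectation (B' i j) (\<lambda>b. real (b q))) = \<Lambda> q * \<tau>' i"
    and "irreducible_chain (polling_kernel P B P' B')"
    and "ergodic_chain (polling_kernel P B P' B')"
  shows "rho_hat \<Lambda> \<tau> \<tau>' < 1 \<and>
    (\<forall>i. \<Lambda> i * tau_bar (server_frequency (polling_kernel P B P' B')) \<Lambda> \<tau> \<tau>'
          < server_frequency (polling_kernel P B P' B') i)"
proof -
  define K where "K = polling_kernel P B P' B'"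
  define \<pi> where "\<pi> = stationary_distribution K"
  have st: "stationary K \<pi>"
    using assms(8) by (simp add: K_def \<pi>_def stationary_stationary_distribution)
  have pos: "pmf \<pi> z > 0" for z
    using stationary_positive[OF _ st] assms(7) by (simp add: K_def)
  have prob_pos: "measure_pmf.prob \<pi> A > 0" if "z \<in> A" for z A
  proof -
    have "z \<in> set_pmf \<pi>"
      using pos[of z] by (simp add: set_pmf_iff)
    then show ?thesis
      using that by (auto simp: zero_less_measure_iff measure_pmf_zero_iff)
  qed

  define G E where "G i = measure_pmf.prob \<pi> {(s, x). s = i \<and> x s > 0}"
    and "E i = measure_pmf.prob \<pi> {(s, x). s = i \<and> x s = 0}" for i
  define F where "F = server_frequency K"
  have G_pos: "G i > 0" for i
    unfolding G_def by (rule prob_pos[of "(i, \<lambda>_. 1)"]) simp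
  have E_pos: "E i > 0" for i
    unfolding E_def by (rule prob_pos[of "(i, \<lambda>_. 0)"]) simp
  have F: "F i = G i + E i" for i
  proof -
    have "{(s, x :: 's \<Rightarrow> nat). s = i} = {(s, x). s = i \<and> x s > 0} \<union> {(s, x). s = i \<and> x s = 0}"
      by auto
    then show ?thesis
      unfolding F_def server_frequency_def \<pi>_def[symmetric] G_def E_def
      by (simp only:) (rule measure_pmf.finite_measure_Union; force)
  qed

  \<comment> \<open>The mean time between polling instants in equilibrium, which turns out to be \<open>tau_bar\<close>.\<close>
  define T where "T = (\<Sum>i\<in>UNIV. G i * \<tau> i + E i * \<tau>' i)"
  have balance: "G q = \<Lambda> q * T" for q
  proof -
    have "G q = (\<Sum>i\<in>UNIV. G i * (\<Lambda> q * \<tau> i) + E i * (\<Lambda> q * \<tau>' i))"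
      unfolding G_def E_def
      by (rule polling_flow_balance[OF assms(1,2,5,6) st[unfolded K_def]])
    then show ?thesis
      by (simp add: T_def sum_distrib_left algebra_simps)
  qed
  have "T \<ge> 0"
    unfolding T_def using assms(3,4) G_pos E_pos
    by (intro sum_nonneg add_nonneg_nonneg mult_nonneg_nonneg) (auto intro: less_imp_le)
  then have T_pos: "T > 0"
    using balance[of undefined] G_pos[of undefined] by (cases "T = 0") auto

  have "T = (\<Sum>i\<in>UNIV. F i * \<tau>' i + G i * (\<tau> i - \<tau>' i))"
    unfolding T_def F by (intro sum.cong) (auto simp: algebra_simps)
  also have "\<dots> = (\<Sum>i\<in>UNIV. F i * \<tau>' i) + rho_hat \<Lambda> \<tau> \<tau>' * T"
    by (simp add: rho_hat_def balance sum.distrib sum_distrib_left mult_ac)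
  finally have T_eq: "T * (1 - rho_hat \<Lambda> \<tau> \<tau>') = (\<Sum>i\<in>UNIV. F i * \<tau>' i)"
    by (simp add: algebra_simps)
  have "(\<Sum>i\<in>UNIV. F i * \<tau>' i) > 0"
  proof -
    obtain i where "\<tau>' i \<noteq> 0"
      using zero_queues_not_absorbing[OF assms(7,2)] assms(6) by (metis mult_zero_right)
    then have "F i * \<tau>' i > 0"
      using assms(4)[of i] by (simp add: F G_pos E_pos add_pos_pos)
    moreover have "F j * \<tau>' j \<ge> 0" for j
      using assms(4)[of j] by (simp add: F G_pos E_pos less_imp_le)
    ultimately show ?thesis
      by (intro sum_pos2[of _ i]) auto
  qed
  then have rho: "rho_hat \<Lambda> \<tau> \<tau>' < 1"
    using T_pos T_eq by (metis diff_gt_0_iff_gt zero_less_mult_pos)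
  then have "tau_bar F \<Lambda> \<tau> \<tau>' = T"
    by (simp add: tau_bar_def T_eq[symmetric])
  then have "\<Lambda> i * tau_bar F \<Lambda> \<tau> \<tau>' < F i" for i
    using balance[of i] E_pos[of i] by (simp add: F)
  with rho show ?thesis by (simp add: F_def K_def)
qed
end
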